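(* Let $d$ be a positive integer and $D$ an orientation of a $d$-regular graph. If $\mathrm{Deg}(D)\neq \mathrm{Deg}(-D)$, then there exists a tournament $T$ such that $f_T(D)\neq f_T(-D)$.
   Context: All graphs and digraphs are finite, without loops or multiple edges/arcs. An orientation of a graph $G$ is a digraph obtained from $G$ by replacing every edge $uv$ by exactly one of the arcs $(u,v)$, $(v,u)$. The converse $-D$ of a digraph $D$ is the digraph on the same vertex set with $(u,v)\in A(-D)$ if and only if $(v,u)\in A(D)$. The degree sequence of a digraph $D$ is the multiset $\mathrm{Deg}(D)=\{(d^+_D(v),d^-_D(v)): v\in V(D)\}$ of pairs (out-degree, in-degree), counted with multiplicity. A tournament is an orientation of a complete graph. For an oriented graph (a digraph with at most one arc between any pair of vertices) $D$ and a tournament $T$, $f_T(D)$ denotes the number of copies of $D$ in $T$, i.e. the number of (not necessarily induced) subdigraphs of $T$ isomorphic to $D$. *)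

theory Defs
  imports "Graph_Theory.Graph_Theory" "HOL-Library.Multiset"
begin

text \<open>
  Digraphs without multiple arcs are pair digraphs of \<^theory>\<open>Graph_Theory.Pair_Digraph\<close>; as in that
  library, a (finite simple undirected) graph is a symmetric loop-free pair digraph
  (\<^const>\<open>pair_graph\<close>), where an edge \<open>uv\<close> is the pair of arcs \<open>(u,v)\<close>, \<open>(v,u)\<close>.
\<close>

definition orientation :: "'a pair_pre_digraph \<Rightarrow> 'a pair_pre_digraph \<Rightarrow> bool" where
  "orientation D G \<longleftrightarrow> pverts D = pverts G \<and> parcs D \<subseteq> parcs G \<and>
     (\<forall>(u,v) \<in> parcs G. ((u,v) \<in> parcs D) \<noteq> ((v,u) \<in> parcs D))"

text \<open>In a symmetric digraph representing a graph, the out-degree is the number of neighbours.\<close>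

definition regular_graph :: "nat \<Rightarrow> 'a pair_pre_digraph \<Rightarrow> bool" where
  "regular_graph d G \<longleftrightarrow> pair_graph G \<and> (\<forall>v \<in> pverts G. out_degree (with_proj G) v = d)"

definition converse_digraph :: "'a pair_pre_digraph \<Rightarrow> 'a pair_pre_digraph" where
  "converse_digraph D = \<lparr> pverts = pverts D, parcs = (parcs D)\<inverse> \<rparr>"

definition degree_sequence :: "'a pair_pre_digraph \<Rightarrow> (nat \<times> nat) multiset" where
  "degree_sequence D =
     image_mset (\<lambda>v. (out_degree (with_proj D) v, in_degree (with_proj D) v)) (mset_set (pverts D))"

definition tournament :: "'a pair_pre_digraph \<Rightarrow> bool" where
  "tournament T \<longleftrightarrow> (\<exists>n G. complete_digraph n (with_proj G) \<and> orientation T G)"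

definition copies :: "'b pair_pre_digraph \<Rightarrow> 'a pair_pre_digraph \<Rightarrow> 'b pair_pre_digraph set" where
  "copies T D = {H. subgraph (with_proj H) (with_proj T) \<and> digraph_iso (with_proj D) (with_proj H)}"

definition num_copies :: "'b pair_pre_digraph \<Rightarrow> 'a pair_pre_digraph \<Rightarrow> nat" where
  "num_copies T D = card (copies T D)"

lemma finite_copies:
  assumes "tournament T"
  shows "finite (copies T D)"
proof -
  from assms obtain n G where G: "complete_digraph n (with_proj G)" "orientation T G"
    unfolding tournament_def by blast
  then interpret pair_graph G by (intro pair_graphI_complete)
  have fin: "finite (pverts T)" "finite (parcs T)"
    using G(2) pair_finite_verts pair_finite_arcs
    by (auto simp: orientation_def intro: finite_subset)
  have "copies T D \<subseteq>
      (\<lambda>(V, A). \<lparr> pverts = V, parcs = A \<rparr>) ` (Pow (pverts T) \<times> Pow (parcs T))"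
  proof
    fix H assume "H \<in> copies T D"
    then have "pverts H \<subseteq> pverts T" "parcs H \<subseteq> parcs T"
      by (auto simp: copies_def subgraph_def)
    then show "H \<in> (\<lambda>(V, A). \<lparr> pverts = V, parcs = A \<rparr>) ` (Pow (pverts T) \<times> Pow (parcs T))"
      by (intro image_eqI[of _ _ "(pverts H, parcs H)"]) auto
  qed
  then show ?thesis
    by (rule finite_subset) (use fin in auto)
qed

end

theory Submission
  imports Defs
begin

text \<open>
  Suppose that every tournament contains as many copies of \<open>D\<close> as of its converse. Let \<open>k\<close> be the
  number of vertices of \<open>D\<close>, and for fixed \<open>p\<close> weight each tournament \<open>T\<close> on a set \<open>V\<close> of \<open>k\<close>
  vertices by the number \<open>w T\<close> of its vertices of out-degree \<open>p\<close>. The sum over all \<open>T\<close> of \<open>w T\<close>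
  times the number of copies of \<open>D\<close> in \<open>T\<close> counts triples of a copy \<open>A\<close> of \<open>D\<close> on \<open>V\<close>, a vertex
  \<open>x\<close>, and a tournament extending \<open>A\<close> in which \<open>x\<close> has out-degree \<open>p\<close>.

  Here regularity enters: if \<open>x\<close> has out-degree \<open>a\<close> in \<open>A\<close>, then exactly \<open>k - 1 - d\<close> pairs at \<open>x\<close>
  are still undecided, of which \<open>p - a\<close> must be directed away from \<open>x\<close>, and the number of undecided
  pairs elsewhere does not depend on \<open>A\<close> or \<open>x\<close>. So the number of extensions is a constant times
  the binomial coefficient \<open>(k - 1 - d) choose (p - a)\<close> (lemma \<open>card_extensions_out_degree\<close>), and
  the weighted sum is a positive constant times the sum of these coefficients over the vertices of
  \<open>D\<close> (lemma \<open>sum_weighted_num_copies\<close>). The converse of \<open>D\<close> yields the same constant, but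
  in-degrees in place of out-degrees.

  Hence the out-degrees and the in-degrees of \<open>D\<close> give the same sums for every \<open>p\<close>. The
  coefficient vanishes for \<open>a > p\<close> and is \<open>1\<close> for \<open>a = p\<close>, so this linear system is triangular and
  every value occurs equally often as an out-degree and as an in-degree (lemma
  \<open>card_fibres_eqI\<close>). As in-degree and out-degree add up to \<open>d\<close>, this is the equality of the two
  degree sequences.
\<close>

section \<open>Tournaments extending an oriented graph\<close>

definition tournaments_on :: "'a set \<Rightarrow> 'a rel set" where
  "tournaments_on V = {R. R \<subseteq> V \<times> V \<and> asym R \<and> total_on V R}"

lemma finite_tournaments_on: "finite V \<Longrightarrow> finite (tournaments_on V)"
  by (rule finite_subset[of _ "Pow (V \<times> V)"]) (auto simp: tournaments_on_def)

lemma tournament_tournaments_on: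
  assumes "finite V" "R \<in> tournaments_on V"
  shows "tournament \<lparr>pverts = V, parcs = R\<rparr>"
proof -
  let ?K = "\<lparr>pverts = V, parcs = {(u,v). (u,v) \<in> V \<times> V \<and> u \<noteq> v}\<rparr>"
  have "complete_digraph (card V) (with_proj ?K)"
    using assms(1) by (simp add: complete_digraph_pair_def)
  moreover have "orientation \<lparr>pverts = V, parcs = R\<rparr> ?K"
    using assms(2)
    by (auto simp: orientation_def tournaments_on_def total_on_def dest: asymD)
  ultimately show ?thesis
    unfolding tournament_def by blast
qed

lemma card_asym_converse:
  assumes "finite A" "asym A"
  shows "card (A \<union> A\<inverse>) = 2 * card A"
proof -
  have "A \<inter> A\<inverse> = {}" using assms(2) by (auto dest: asymD)
  then show ?thesis
    using assms(1) by (simp add: card_Un_disjoint)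
qed

lemma card_off_diagonal:
  assumes "finite V"
  shows "card (V \<times> V - Id) = 2 * (card V choose 2)"
proof -
  have diag: "V \<times> V \<inter> Id = (\<lambda>x. (x,x)) ` V" by auto
  have "card (V \<times> V - Id) = card (V \<times> V) - card (V \<times> V \<inter> Id)"
    using assms by (intro card_Diff_subset_Int) auto
  also have "card (V \<times> V \<inter> Id) = card V"
    unfolding diag by (rule card_image) (auto simp: inj_on_def)
  also have "card (V \<times> V) - card V = card V * (card V - 1)"
    by (simp add: card_cartesian_product diff_mult_distrib2)
  finally show ?thesis
    by (cases "card V") (simp_all add: choose_two)
qed

lemma card_asym_le:
  assumes "finite V" "A \<subseteq> V \<times> V" "asym A"
  shows "card A \<le> (card V choose 2)"
proof -
  have "A \<union> A\<inverse> \<subseteq> V \<times> V - Id"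
    using assms by (auto dest: asymD)
  then have "card (A \<union> A\<inverse>) \<le> card (V \<times> V - Id)"
    using assms by (intro card_mono) auto
  then show ?thesis
    using assms card_asym_converse[of A] card_off_diagonal[of V] finite_subset[of A] by auto
qed

text \<open>
  Each of the unordered pairs that \<open>A\<close> leaves undecided can be directed in two ways. The induction
  decides one such pair at a time.
\<close>

lemma card_tournament_extensions:
  assumes "finite V" "A \<subseteq> V \<times> V" "asym A"
  shows "card {R \<in> tournaments_on V. A \<subseteq> R} = 2 ^ ((card V choose 2) - card A)"
  using assms(2,3)
proof (induction "(card V choose 2) - card A" arbitrary: A rule: less_induct)
  case less
  have finA: "finite A"
    using less.prems(1) assms(1) by (meson finite_SigmaI finite_subset)
  show ?case
  proof (cases "total_on V A")
    case True
    have "A \<union> A\<inverse> = V \<times> V - Id"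
      using True less.prems by (auto simp: total_on_def dest: asymD)
    then have "card A = (card V choose 2)"
      using card_asym_converse[OF finA less.prems(2)] card_off_diagonal[OF assms(1)] by simp
    moreover have "{R \<in> tournaments_on V. A \<subseteq> R} = {A}"
    proof (intro equalityI subsetI)
      fix R assume R: "R \<in> {R \<in> tournaments_on V. A \<subseteq> R}"
      have "R \<subseteq> A"
      proof (rule subrelI)
        fix u v assume uv: "(u,v) \<in> R"
        then have "u \<in> V" "v \<in> V" "u \<noteq> v" "(v,u) \<notin> A"
          using R by (auto simp: tournaments_on_def dest: asymD)
        then show "(u,v) \<in> A" using True by (auto simp: total_on_def)
      qed
      then show "R \<in> {A}" using R by auto
    qed (use True less.prems in \<open>simp add: tournaments_on_def\<close>)
    ultimately show ?thesis by simp
  next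
    case False
    then obtain u v where uv: "u \<in> V" "v \<in> V" "u \<noteq> v" "(u,v) \<notin> A" "(v,u) \<notin> A"
      by (auto simp: total_on_def)
    have step: "card {R \<in> tournaments_on V. insert (x,y) A \<subseteq> R}
        = 2 ^ ((card V choose 2) - Suc (card A)) \<and> card A < (card V choose 2)"
      if "(x,y) = (u,v) \<or> (x,y) = (v,u)" for x y
    proof -
      have sub: "insert (x,y) A \<subseteq> V \<times> V" and asy: "asym (insert (x,y) A)"
        and new: "(x,y) \<notin> A"
        using that uv less.prems by (auto intro!: asymI dest: asymD)
      have "Suc (card A) \<le> (card V choose 2)"
        using card_asym_le[OF assms(1) sub asy] new finA by simp
      then show ?thesis
        using less.hyps[OF _ sub asy] new finA by simp
    qed
    have split: "{R \<in> tournaments_on V. A \<subseteq> R} =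
        {R \<in> tournaments_on V. insert (u,v) A \<subseteq> R} \<union> {R \<in> tournaments_on V. insert (v,u) A \<subseteq> R}"
      using uv by (auto simp: tournaments_on_def total_on_def)
    have disj: "{R \<in> tournaments_on V. insert (u,v) A \<subseteq> R} \<inter>
        {R \<in> tournaments_on V. insert (v,u) A \<subseteq> R} = {}"
      by (auto simp: tournaments_on_def dest: asymD)
    have "card {R \<in> tournaments_on V. A \<subseteq> R} = 2 * 2 ^ ((card V choose 2) - Suc (card A))"
      unfolding split
      using step[of u v] step[of v u] finite_tournaments_on[OF assms(1)]
      by (subst card_Un_disjoint[OF _ _ disj]) auto
    also have "\<dots> = 2 ^ ((card V choose 2) - card A)"
      using step[of u v] by (simp flip: power_Suc add: Suc_diff_Suc)
    finally show ?thesis .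
  qed
qed

text \<open>
  The case distinction is needed because subtraction on the naturals truncates: for \<open>a > p\<close> the
  value must be \<open>0\<close>, not \<open>m choose 0\<close>.
\<close>

definition shifted_binomial :: "nat \<Rightarrow> nat \<Rightarrow> nat \<Rightarrow> nat" where
  "shifted_binomial m p a = (if a \<le> p then m choose (p - a) else 0)"

text \<open>
  The extensions are sorted by the set \<open>B\<close> of those vertices not adjacent to \<open>x\<close> in \<open>A\<close> that become
  out-neighbours of \<open>x\<close>. Fixing \<open>B\<close> decides all pairs at \<open>x\<close>, and the result is again an oriented
  graph to which \<open>card_tournament_extensions\<close> applies; its number of arcs is the same for every \<open>B\<close>.
\<close>

lemma card_extensions_out_degree:
  assumes V: "finite V" and A: "A \<subseteq> V \<times> V" "asym A" and x: "x \<in> V"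
    and deg: "card (A `` {x}) + card (A\<inverse> `` {x}) = d"
  shows "card {R \<in> tournaments_on V. A \<subseteq> R \<and> card (R `` {x}) = p} =
    2 ^ ((card V choose 2) - (card A + (card V - 1 - d))) *
      shifted_binomial (card V - 1 - d) p (card (A `` {x}))"
proof -
  define F where "F = V - {x} - (A `` {x} \<union> A\<inverse> `` {x})"
  have finA: "finite A" and fin_out: "finite (A `` {x})" and fin_in: "finite (A\<inverse> `` {x})"
    and finF: "finite F"
    using A V finite_subset[of A "V \<times> V"] by (auto simp: F_def)
  have nbrs: "A `` {x} \<union> A\<inverse> `` {x} \<subseteq> V - {x}" "A `` {x} \<inter> A\<inverse> `` {x} = {}"
    using A by (auto dest: asymD)
  have cardF: "card F = card V - 1 - d"
    unfolding F_def deg[symmetric]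
    using nbrs fin_out fin_in V x by (simp add: card_Diff_subset card_Un_disjoint)
  \<comment> \<open>\<open>F\<close> consists of the vertices whose arc to or from \<open>x\<close> is undecided in \<open>A\<close>;
      \<open>ext B\<close> directs \<open>x\<close> to \<open>B\<close> and the rest of \<open>F\<close> to \<open>x\<close>.\<close>
  define ext where "ext B = A \<union> {x} \<times> B \<union> (F - B) \<times> {x}" for B
  have ext: "card {R \<in> tournaments_on V. ext B \<subseteq> R} =
      2 ^ ((card V choose 2) - (card A + card F))" if "B \<subseteq> F" for B
  proof -
    have finB: "finite B" using that finF by (rule finite_subset)
    have "card ({x} \<times> B \<union> (F - B) \<times> {x}) = card B + card (F - B)"
      using finB finF by (subst card_Un_disjoint) (auto simp: F_def card_cartesian_product)
    also have "\<dots> = card F"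
      using that finB finF by (simp add: card_Diff_subset card_mono)
    finally have "card (ext B) = card A + card F"
      unfolding ext_def Un_assoc
      using that finA finB finF
      by (subst card_Un_disjoint) (auto simp: F_def)
    moreover have "ext B \<subseteq> V \<times> V" "asym (ext B)"
      using A x that unfolding ext_def F_def by (auto intro!: asymI dest: asymD)
    ultimately show ?thesis
      using card_tournament_extensions[OF V, of "ext B"] by simp
  qed
  have out: "R `` {x} = A `` {x} \<union> B" if "R \<in> tournaments_on V" "ext B \<subseteq> R" "B \<subseteq> F" for R B
  proof (intro equalityI subsetI)
    fix y assume "y \<in> R `` {x}"
    then have "y \<in> V" "y \<noteq> x" "(y,x) \<notin> R"
      using that(1) by (auto simp: tournaments_on_def dest: asymD)
    then have "y \<notin> F - B" "(y,x) \<notin> A"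
      using that(2) by (auto simp: ext_def)
    then show "y \<in> A `` {x} \<union> B"
      using \<open>y \<in> V\<close> \<open>y \<noteq> x\<close> by (auto simp: F_def)
  qed (use that(2) in \<open>auto simp: ext_def\<close>)
  have card_out: "card (A `` {x} \<union> B) = card (A `` {x}) + card B" if "B \<subseteq> F" for B
    using that finF finite_subset[OF that] fin_out by (subst card_Un_disjoint) (auto simp: F_def)
  have dec: "ext (R `` {x} \<inter> F) \<subseteq> R" if "R \<in> tournaments_on V" "A \<subseteq> R" for R
    using that x unfolding ext_def F_def tournaments_on_def by (auto simp: total_on_def)
  show ?thesis
  proof (cases "card (A `` {x}) \<le> p")
    case True
    define \<B> where "\<B> = {B. B \<subseteq> F \<and> card B = p - card (A `` {x})}"
    have "{R \<in> tournaments_on V. A \<subseteq> R \<and> card (R `` {x}) = p} =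
        (\<Union>B\<in>\<B>. {R \<in> tournaments_on V. ext B \<subseteq> R})" (is "?L = ?R")
    proof (intro equalityI subsetI)
      fix R assume R: "R \<in> ?L"
      let ?B = "R `` {x} \<inter> F"
      have sub: "ext ?B \<subseteq> R" using dec R by blast
      then have "card (R `` {x}) = card (A `` {x}) + card ?B"
        using out[of R ?B] card_out[of ?B] R by simp
      then have "?B \<in> \<B>" using R by (auto simp: \<B>_def)
      then show "R \<in> ?R" using sub R by blast
    next
      fix R assume "R \<in> ?R"
      then obtain B where B: "B \<subseteq> F" "card B = p - card (A `` {x})" "R \<in> tournaments_on V" "ext B \<subseteq> R"
        by (auto simp: \<B>_def)
      then show "R \<in> ?L"
        using out[of R B] card_out[of B] True by (auto simp: ext_def)
    qed
    also have "card \<dots> = (\<Sum>B\<in>\<B>. card {R \<in> tournaments_on V. ext B \<subseteq> R})"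
    proof (rule card_UN_disjoint)
      show "finite \<B>" using finF by (auto simp: \<B>_def)
      show "\<forall>B\<in>\<B>. finite {R \<in> tournaments_on V. ext B \<subseteq> R}"
        using finite_tournaments_on[OF V] by simp
      have "B = B'" if "B \<in> \<B>" "B' \<in> \<B>" "R \<in> tournaments_on V" "ext B \<subseteq> R" "ext B' \<subseteq> R" for R B B'
      proof -
        have "A `` {x} \<union> B = A `` {x} \<union> B'"
          using out[of R B] out[of R B'] that by (auto simp: \<B>_def)
        then show ?thesis using that(1,2) by (auto simp: \<B>_def F_def)
      qed
      then show "\<forall>B\<in>\<B>. \<forall>B'\<in>\<B>. B \<noteq> B' \<longrightarrow>
          {R \<in> tournaments_on V. ext B \<subseteq> R} \<inter> {R \<in> tournaments_on V. ext B' \<subseteq> R} = {}"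
        by blast
    qed
    also have "\<dots> = card \<B> * 2 ^ ((card V choose 2) - (card A + card F))"
      using ext by (simp add: \<B>_def)
    also have "card \<B> = card F choose (p - card (A `` {x}))"
      unfolding \<B>_def by (rule n_subsets[OF finF])
    finally show ?thesis
      using True by (simp add: cardF shifted_binomial_def mult.commute)
  next
    case False
    have "card (R `` {x}) \<noteq> p" if "R \<in> tournaments_on V" "A \<subseteq> R" for R
      using out[of R "R `` {x} \<inter> F"] card_out[of "R `` {x} \<inter> F"] dec that False by auto
    then have "{R \<in> tournaments_on V. A \<subseteq> R \<and> card (R `` {x}) = p} = {}" by blast
    then show ?thesis using False by (simp only: card.empty shifted_binomial_def if_False mult_0_right)
  qed
qed

definition num_out_degree :: "'a set \<Rightarrow> 'a rel \<Rightarrow> nat \<Rightarrow> nat" where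
  "num_out_degree V R p = card {x \<in> V. card (R `` {x}) = p}"

lemma sum_num_out_degree_extensions:
  assumes "finite V" "A \<subseteq> V \<times> V" "asym A"
    and "\<And>x. x \<in> V \<Longrightarrow> card (A `` {x}) + card (A\<inverse> `` {x}) = d"
  shows "(\<Sum>R \<in> {R \<in> tournaments_on V. A \<subseteq> R}. num_out_degree V R p) =
    2 ^ ((card V choose 2) - (card A + (card V - 1 - d))) *
      (\<Sum>x\<in>V. shifted_binomial (card V - 1 - d) p (card (A `` {x})))"
  unfolding num_out_degree_def sum_distrib_left
proof (rule sum_multicount_gen)
  show "finite {R \<in> tournaments_on V. A \<subseteq> R}"
    using finite_tournaments_on[OF assms(1)] by simp
  show "\<forall>x\<in>V. card {R \<in> {R \<in> tournaments_on V. A \<subseteq> R}. card (R `` {x}) = p} =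
      2 ^ ((card V choose 2) - (card A + (card V - 1 - d))) *
        shifted_binomial (card V - 1 - d) p (card (A `` {x}))"
    using card_extensions_out_degree[OF assms(1-3) _ assms(4)] by (simp add: conj_assoc)
qed (fact assms(1))

section \<open>Copies as relabelled arc sets\<close>

definition placements :: "'a pair_pre_digraph \<Rightarrow> 'b set \<Rightarrow> 'b rel set" where
  "placements D V = {map_prod f f ` parcs D | f. bij_betw f (pverts D) V}"

lemma finite_placements:
  assumes "pair_wf_digraph D" "finite V"
  shows "finite (placements D V)"
proof (rule finite_subset)
  interpret pair_wf_digraph D by (fact assms(1))
  show "placements D V \<subseteq> Pow (V \<times> V)"
    by (auto simp: placements_def bij_betw_def dest: in_arcsD1 in_arcsD2)
qed (use assms(2) in simp)

text \<open>
  The isomorphisms of the library carry separate maps on vertices and on arcs. Between digraphs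
  whose arcs are pairs the arc map is forced by the vertex map.
\<close>

lemma digraph_iso_with_proj_iff:
  assumes "pair_wf_digraph D"
  shows "digraph_iso (with_proj D) (with_proj H) \<longleftrightarrow> parcs H \<in> placements D (pverts H)"
proof
  assume "digraph_iso (with_proj D) (with_proj H)"
  then obtain h where h: "pre_digraph.digraph_isomorphism (with_proj D) h"
      "with_proj H = app_iso h (with_proj D)"
    by (auto simp: digraph_iso_def)
  let ?f = "iso_verts h"
  have proj: "iso_tail h = fst" "iso_head h = snd"
    and vH: "pverts H = ?f ` pverts D" and aH: "parcs H = iso_arcs h ` parcs D"
    using arg_cong[OF h(2), of tail] arg_cong[OF h(2), of head] arg_cong[OF h(2), of verts]
      arg_cong[OF h(2), of arcs] by simp_all
  have "iso_arcs h a = map_prod ?f ?f a" if "a \<in> parcs D" for a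
    using h(1) that proj
    by (cases a) (auto simp: pre_digraph.digraph_isomorphism_def prod_eq_iff)
  then have "parcs H = map_prod ?f ?f ` parcs D"
    unfolding aH by (rule image_cong[OF refl])
  moreover have "bij_betw ?f (pverts D) (pverts H)"
    using h(1) vH by (auto simp: pre_digraph.digraph_isomorphism_def bij_betw_def)
  ultimately show "parcs H \<in> placements D (pverts H)"
    unfolding placements_def by blast
next
  assume "parcs H \<in> placements D (pverts H)"
  then obtain f where f: "bij_betw f (pverts D) (pverts H)" "parcs H = map_prod f f ` parcs D"
    by (auto simp: placements_def)
  interpret pair_wf_digraph D by (fact assms)
  define h where "h = \<lparr>iso_verts = f, iso_arcs = map_prod f f, iso_head = snd, iso_tail = fst\<rparr>"
  have "inj_on (map_prod f f) (parcs D)"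
    using f(1) by (intro inj_on_subset[OF map_prod_inj_on[of f "pverts D" f "pverts D"]])
      (auto simp: bij_betw_def dest: in_arcsD1 in_arcsD2)
  then have "digraph_isomorphism h"
    using f(1) wf_digraph_wp_iff[of D] assms by (simp add: digraph_isomorphism_def h_def bij_betw_def)
  moreover have "with_proj H = app_iso h (with_proj D)"
    using f by (simp add: with_proj_def app_iso_def h_def bij_betw_def)
  ultimately show "digraph_iso (with_proj D) (with_proj H)"
    unfolding digraph_iso_def by blast
qed

text \<open>
  When the tournament has as many vertices as \<open>D\<close>, every copy of \<open>D\<close> is spanning, so that a copy is
  determined by its arc set.
\<close>

lemma num_copies_spanning:
  assumes D: "pair_wf_digraph D" and fin: "finite V" "card V = card (pverts D)"
    and R: "R \<in> tournaments_on V"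
  shows "num_copies \<lparr>pverts = V, parcs = R\<rparr> D = card {A \<in> placements D V. A \<subseteq> R}"
proof -
  have "copies \<lparr>pverts = V, parcs = R\<rparr> D =
      (\<lambda>A. \<lparr>pverts = V, parcs = A\<rparr>) ` {A \<in> placements D V. A \<subseteq> R}" (is "?L = ?R")
  proof (intro equalityI subsetI)
    fix H assume "H \<in> ?L"
    then have H: "pverts H \<subseteq> V" "parcs H \<subseteq> R" "parcs H \<in> placements D (pverts H)"
      using digraph_iso_with_proj_iff[OF D] by (auto simp: copies_def subgraph_def)
    then have "card (pverts H) = card V"
      using fin by (auto simp: placements_def dest: bij_betw_same_card)
    then have "pverts H = V"
      using H(1) fin by (intro card_subset_eq) auto
    with H show "H \<in> ?R"
      by (intro image_eqI[of _ _ "parcs H"]) auto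
  next
    fix H assume "H \<in> ?R"
    then obtain A where A: "H = \<lparr>pverts = V, parcs = A\<rparr>" "A \<in> placements D V" "A \<subseteq> R"
      by blast
    moreover have "wf_digraph (with_proj \<lparr>pverts = V, parcs = B\<rparr>)" if "B \<subseteq> R" for B
      using that R by unfold_locales (auto simp: tournaments_on_def)
    ultimately show "H \<in> ?L"
      using digraph_iso_with_proj_iff[OF D, of H]
      by (auto simp: copies_def subgraph_def compatible_def)
  qed
  moreover have "inj_on (\<lambda>A. \<lparr>pverts = V, parcs = A\<rparr>) {A \<in> placements D V. A \<subseteq> R}"
    by (auto simp: inj_on_def)
  ultimately show ?thesis
    by (simp add: num_copies_def card_image)
qed

lemma placements_converse:
  fixes D :: "'a pair_pre_digraph" and V :: "'b set"
  shows "placements (converse_digraph D) V = converse ` placements D V"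
proof -
  have "map_prod f f ` (parcs D)\<inverse> = (map_prod f f ` parcs D)\<inverse>" for f :: "'a \<Rightarrow> 'b"
    by force
  then show ?thesis
    by (simp add: placements_def converse_digraph_def setcompr_eq_image image_image)
qed

text \<open>
  Exchanging the order of summation turns the left-hand side into a sum over the placements \<open>A\<close> of
  \<open>D\<close>. All placements contribute equally, since their inner sum depends only on the degrees of \<open>A\<close>,
  which are those of \<open>D\<close>.
\<close>

lemma sum_weighted_num_copies:
  assumes wf: "pair_wf_digraph D" and fin: "finite V" "card V = card (pverts D)"
    and asy: "asym (parcs D)"
    and deg: "\<And>v. v \<in> pverts D \<Longrightarrow> card (parcs D `` {v}) + card ((parcs D)\<inverse> `` {v}) = d"
  shows "(\<Sum>R\<in>tournaments_on V. num_out_degree V R p * num_copies \<lparr>pverts = V, parcs = R\<rparr> D) =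
    card (placements D V) *
    (2 ^ ((card V choose 2) - (card (parcs D) + (card V - 1 - d))) *
      (\<Sum>v\<in>pverts D. shifted_binomial (card V - 1 - d) p (card (parcs D `` {v}))))"
    (is "_ = _ * ?c")
proof -
  interpret pair_wf_digraph D by (fact wf)
  have A: "(\<Sum>R \<in> {R \<in> tournaments_on V. A \<subseteq> R}. num_out_degree V R p) = ?c"
    if A_placed: "A \<in> placements D V" for A
  proof -
    obtain f where f: "bij_betw f (pverts D) V" and A: "A = map_prod f f ` parcs D"
      using A_placed by (auto simp: placements_def)
    have inj: "inj_on f (pverts D)" and V: "V = f ` pverts D"
      using f by (auto simp: bij_betw_def)
    have eq: "f u = f v \<longleftrightarrow> u = v" if "u \<in> pverts D" "v \<in> pverts D" for u v
      using inj that by (auto dest: inj_onD)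
    have sub: "A \<subseteq> V \<times> V"
      unfolding A V by (auto dest: in_arcsD1 in_arcsD2)
    have mem: "(f u, f v) \<in> A \<longleftrightarrow> (u,v) \<in> parcs D" if uv: "u \<in> pverts D" "v \<in> pverts D" for u v
    proof
      assume "(f u, f v) \<in> A"
      then obtain u' v' where "(u',v') \<in> parcs D" "f u = f u'" "f v = f v'"
        unfolding A by auto
      moreover from this have "u = u'" "v = v'"
        using uv in_arcsD1 in_arcsD2 by (simp_all add: eq)
      ultimately show "(u,v) \<in> parcs D" by simp
    qed (auto simp: A)
    have "asym A"
    proof (rule asymI)
      fix a b assume ab: "(a,b) \<in> A"
      then obtain u v where "u \<in> pverts D" "v \<in> pverts D" "a = f u" "b = f v"
        using sub V by auto
      then show "(b,a) \<notin> A" using ab mem asy by (auto dest: asymD)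
    qed
    have img: "A `` {f v} = f ` (parcs D `` {v})" "A\<inverse> `` {f v} = f ` ((parcs D)\<inverse> `` {v})"
      if v: "v \<in> pverts D" for v
    proof -
      have "a \<in> f ` pverts D" if "(f v, a) \<in> A \<or> (a, f v) \<in> A" for a
        using that sub V by auto
      then show "A `` {f v} = f ` (parcs D `` {v})" "A\<inverse> `` {f v} = f ` ((parcs D)\<inverse> `` {v})"
        using mem v in_arcsD1 in_arcsD2 by blast+
    qed
    have card_img: "card (A `` {f v}) = card (parcs D `` {v})"
        "card (A\<inverse> `` {f v}) = card ((parcs D)\<inverse> `` {v})" if "v \<in> pverts D" for v
      unfolding img[OF that]
      by (auto intro!: card_image inj_on_subset[OF inj] dest: in_arcsD1 in_arcsD2)
    have "card A = card (parcs D)"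
      unfolding A
      using inj by (intro card_image inj_on_subset[OF map_prod_inj_on[of f "pverts D" f "pverts D"]])
        (auto dest: in_arcsD1 in_arcsD2)
    moreover have "card (A `` {x}) + card (A\<inverse> `` {x}) = d" if "x \<in> V" for x
      using that deg card_img unfolding V by auto
    moreover have "(\<Sum>x\<in>V. shifted_binomial (card V - 1 - d) p (card (A `` {x}))) =
        (\<Sum>v\<in>pverts D. shifted_binomial (card V - 1 - d) p (card (parcs D `` {v})))"
      by (subst sum.reindex_bij_betw[OF f, symmetric]) (simp add: card_img)
    ultimately show ?thesis
      using sum_num_out_degree_extensions[OF fin(1) sub \<open>asym A\<close>, of d p] by simp
  qed
  have "(\<Sum>R\<in>tournaments_on V. num_out_degree V R p * num_copies \<lparr>pverts = V, parcs = R\<rparr> D) =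
      (\<Sum>R\<in>tournaments_on V. \<Sum>A | A \<in> placements D V \<and> A \<subseteq> R. num_out_degree V R p)"
    by (simp add: num_copies_spanning[OF wf fin] mult.commute)
  also have "\<dots> = (\<Sum>A\<in>placements D V. \<Sum>R | R \<in> tournaments_on V \<and> A \<subseteq> R. num_out_degree V R p)"
    by (rule sum.swap_restrict[OF finite_tournaments_on[OF fin(1)] finite_placements[OF wf fin(1)]])
  also have "\<dots> = card (placements D V) * ?c"
    using A by simp
  finally show ?thesis .
qed

section \<open>Recovering the degrees\<close>

text \<open>
  The sum for \<open>p = a\<close> is the size of the fibre over \<open>a\<close> plus a combination of the sizes of the fibres
  over smaller values, which agree by induction.
\<close>

lemma card_fibres_eqI:
  fixes f g :: "'a \<Rightarrow> nat"
  assumes fin: "finite S"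
    and eq: "\<And>p. (\<Sum>v\<in>S. shifted_binomial m p (f v)) = (\<Sum>v\<in>S. shifted_binomial m p (g v))"
  shows "card {v \<in> S. f v = a} = card {v \<in> S. g v = a}"
proof (induction a rule: less_induct)
  case (less a)
  have expand: "(\<Sum>v\<in>S. shifted_binomial m a (h v)) =
      card {v \<in> S. h v = a} + (\<Sum>i<a. card {v \<in> S. h v = i} * (m choose (a - i)))"
    for h :: "'a \<Rightarrow> nat"
  proof -
    have "(\<Sum>v\<in>S. shifted_binomial m a (h v)) =
        (\<Sum>v\<in>S. \<Sum>i\<le>a. if h v = i then m choose (a - i) else 0)"
      by (simp add: shifted_binomial_def)
    also have "\<dots> = (\<Sum>i\<le>a. \<Sum>v\<in>S. if h v = i then m choose (a - i) else 0)"
      by (rule sum.swap)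
    also have "\<dots> = (\<Sum>i\<le>a. card {v \<in> S. h v = i} * (m choose (a - i)))"
      using fin by (simp add: sum.If_cases Collect_conj_eq)
    also have "\<dots> = card {v \<in> S. h v = a} + (\<Sum>i<a. card {v \<in> S. h v = i} * (m choose (a - i)))"
      by (simp flip: lessThan_Suc_atMost)
    finally show ?thesis .
  qed
  have "(\<Sum>i<a. card {v \<in> S. f v = i} * (m choose (a - i))) =
      (\<Sum>i<a. card {v \<in> S. g v = i} * (m choose (a - i)))"
    using less.IH by (intro sum.cong) auto
  then show ?case
    using eq[of a] expand[of f] expand[of g] by simp
qed

lemma out_degree_with_proj: "out_degree (with_proj D) v = card (parcs D `` {v})"
proof -
  have "out_arcs (with_proj D) v = Pair v ` (parcs D `` {v})"
    by (auto simp: out_arcs_def)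
  then show ?thesis by (simp add: out_degree_def card_image inj_on_def)
qed

lemma in_degree_with_proj: "in_degree (with_proj D) v = card ((parcs D)\<inverse> `` {v})"
proof -
  have "in_arcs (with_proj D) v = (\<lambda>u. (u,v)) ` ((parcs D)\<inverse> `` {v})"
    by (auto simp: in_arcs_def)
  then show ?thesis by (simp add: in_degree_def card_image inj_on_def)
qed

lemma count_degree_sequence:
  assumes "finite (pverts D)"
  shows "count (degree_sequence D) (a, b) =
    card {v \<in> pverts D. card (parcs D `` {v}) = a \<and> card ((parcs D)\<inverse> `` {v}) = b}"
proof -
  have "count (degree_sequence D) (a, b) = (\<Sum>v | v \<in> pverts D \<and>
      (a, b) = (card (parcs D `` {v}), card ((parcs D)\<inverse> `` {v})). 1)"
    unfolding degree_sequence_def out_degree_with_proj in_degree_with_proj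
    using assms by (simp add: count_image_mset' eq_commute)
  then show ?thesis by (simp add: eq_commute)
qed

text \<open>
  When out-degree and in-degree add up to \<open>d\<close>, the pair of both is determined by either of them.
\<close>

lemma degree_sequence_converse_eqI:
  assumes fin: "finite (pverts D)"
    and deg: "\<And>v. v \<in> pverts D \<Longrightarrow> card (parcs D `` {v}) + card ((parcs D)\<inverse> `` {v}) = d"
    and eq: "\<And>a. card {v \<in> pverts D. card (parcs D `` {v}) = a} =
      card {v \<in> pverts D. card ((parcs D)\<inverse> `` {v}) = a}"
  shows "degree_sequence D = degree_sequence (converse_digraph D)"
proof (rule multiset_eqI)
  fix ab :: "nat \<times> nat"
  obtain a b where ab: "ab = (a, b)" by force
  have 1: "{v \<in> pverts D. card (parcs D `` {v}) = a \<and> card ((parcs D)\<inverse> `` {v}) = b} =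
      (if a + b = d then {v \<in> pverts D. card (parcs D `` {v}) = a} else {})"
    using deg by force
  have 2: "{v \<in> pverts D. card ((parcs D)\<inverse> `` {v}) = a \<and> card (parcs D `` {v}) = b} =
      (if a + b = d then {v \<in> pverts D. card ((parcs D)\<inverse> `` {v}) = a} else {})"
    using deg by force
  show "count (degree_sequence D) ab = count (degree_sequence (converse_digraph D)) ab"
    using fin eq[of a] 1 2
    by (simp add: ab count_degree_sequence converse_digraph_def)
qed

lemma orientation_regularD:
  assumes "regular_graph d G" "orientation D G"
  shows "finite (pverts D)" "pair_wf_digraph D" "asym (parcs D)"
    and "v \<in> pverts D \<Longrightarrow> card (parcs D `` {v}) + card ((parcs D)\<inverse> `` {v}) = d"
proof -
  interpret pair_graph G using assms(1) by (simp add: regular_graph_def)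
  have verts: "pverts D = pverts G" and sub: "parcs D \<subseteq> parcs G"
    and one: "\<And>u v. (u,v) \<in> parcs G \<Longrightarrow> ((u,v) \<in> parcs D) \<noteq> ((v,u) \<in> parcs D)"
    using assms(2) by (auto simp: orientation_def)
  have sym: "(v,u) \<in> parcs G" if "(u,v) \<in> parcs G" for u v
    using that pair_sym_arcs by (auto simp: symmetric_def dest: symD)
  show "finite (pverts D)" using verts pair_finite_verts by simp
  show "pair_wf_digraph D"
    using sub verts in_arcsD1 in_arcsD2 by unfold_locales auto
  show asy: "asym (parcs D)"
    using sub one by (auto intro!: asymI)
  show "card (parcs D `` {v}) + card ((parcs D)\<inverse> `` {v}) = d" if "v \<in> pverts D"
  proof -
    have fin: "finite (parcs D)" using sub pair_finite_arcs by (rule finite_subset)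
    have "parcs G `` {v} = parcs D `` {v} \<union> (parcs D)\<inverse> `` {v}"
      using sub one sym by blast
    moreover have "parcs D `` {v} \<inter> (parcs D)\<inverse> `` {v} = {}"
      using asy by (auto dest: asymD)
    moreover have "card (parcs G `` {v}) = d"
      using assms(1) that verts by (simp add: regular_graph_def out_degree_with_proj)
    ultimately show ?thesis
      using fin by (simp add: card_Un_disjoint)
  qed
qed

theorem theorem3p5:
  fixes d :: nat and G D :: "'a pair_pre_digraph"
  assumes "d > 0"
    and "regular_graph d G"
    and "orientation D G"
    and "degree_sequence D \<noteq> degree_sequence (converse_digraph D)"
  shows "\<exists>T :: nat pair_pre_digraph. tournament T \<and>
           num_copies T D \<noteq> num_copies T (converse_digraph D)"
proof (rule ccontr)
  assume no_T: "\<not> ?thesis"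
  note D = orientation_regularD[OF assms(2,3)]
  let ?D' = "converse_digraph D"
  have parcs': "parcs ?D' = (parcs D)\<inverse>" and verts': "pverts ?D' = pverts D"
    by (simp_all add: converse_digraph_def)
  \<comment> \<open>Tournaments on exactly as many vertices as \<open>D\<close> suffice.\<close>
  define V where "V = {..<card (pverts D)}"
  have V: "finite V" "card V = card (pverts D)" "card V = card (pverts ?D')"
    by (simp_all add: V_def verts')
  have wf': "pair_wf_digraph ?D'"
    using D(2) by (auto simp: pair_wf_digraph_def parcs' verts')
  have asym': "asym (parcs ?D')"
    using D(3) by (auto simp: parcs' intro!: asymI dest: asymD)
  have deg': "card (parcs ?D' `` {v}) + card ((parcs ?D')\<inverse> `` {v}) = d" if "v \<in> pverts ?D'" for v
    using D(4)[of v] that by (simp add: parcs' verts')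
  have card_placements: "card (placements ?D' V) = card (placements D V)"
    unfolding placements_converse by (intro card_image) (auto simp: inj_on_def)
  have "placements D V \<noteq> {}"
    using finite_same_card_bij[OF D(1) V(1)] V(2) by (auto simp: placements_def)
  then have pos: "card (placements D V) > 0"
    using finite_placements[OF D(2) V(1)] by (simp add: card_gt_0_iff)
  have same: "num_copies \<lparr>pverts = V, parcs = R\<rparr> D = num_copies \<lparr>pverts = V, parcs = R\<rparr> ?D'"
    if "R \<in> tournaments_on V" for R
    using no_T tournament_tournaments_on[OF V(1) that] by blast
  have "(\<Sum>v\<in>pverts D. shifted_binomial (card V - 1 - d) p (card (parcs D `` {v}))) =
      (\<Sum>v\<in>pverts D. shifted_binomial (card V - 1 - d) p (card ((parcs D)\<inverse> `` {v})))" for p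
    using sum_weighted_num_copies[OF D(2) V(1,2) D(3,4), of p]
      sum_weighted_num_copies[OF wf' V(1,3) asym' deg', of p] same pos
    by (simp add: card_placements parcs' verts')
  then have "degree_sequence D = degree_sequence ?D'"
    by (intro degree_sequence_converse_eqI[OF D(1,4)] card_fibres_eqI[OF D(1)])
  with assms(4) show False by contradiction
qed

end
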